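(* Any (nondegenerate) parallelogram in the Euclidean plane is a closed billiard trajectory within an ellipse. Moreover, such an ellipse is uniquely determined for a given parallelogram.
   Context: A billiard trajectory within an ellipse $\mathcal{E}$ is a polygonal line with all vertices on $\mathcal{E}$ such that any two consecutive sides satisfy the billiard reflection law at their common vertex: they form congruent angles with the tangent line to $\mathcal{E}$ at that vertex (equivalently, the tangent line is the bisector of the exterior angle formed by the two sides). A closed polygon is a closed billiard trajectory within $\mathcal{E}$ if its vertices lie on $\mathcal{E}$ and the reflection law holds at each of its vertices. Circles are regarded as ellipses (with coinciding foci). *)

theory Defs
  imports "HOL-Analysis.Analysis"
begin

text \<open>Gardener's definition. The condition \<open>dist F1 F2 < c\<close> excludes segments and
  the empty set; \<open>F1 = F2\<close> is allowed and gives circles.\<close>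

definition ellipse :: "(real^2) set \<Rightarrow> bool" where
  "ellipse E \<longleftrightarrow>
     (\<exists>F1 F2 c. dist F1 F2 < c \<and> E = {X. dist X F1 + dist X F2 = c})"

text \<open>Velocities at \<open>P\<close> of curves that run inside \<open>S\<close>; they need only be differentiable at
  the parameter 0, where they pass through \<open>P\<close>.\<close>

definition tangent_vectors :: "(real^2) set \<Rightarrow> real^2 \<Rightarrow> (real^2) set" where
  "tangent_vectors S P =
     {v. \<exists>\<gamma>. \<gamma> 0 = P \<and> (\<forall>t. \<gamma> t \<in> S) \<and> (\<gamma> has_vector_derivative v) (at 0)}"

text \<open>\<open>S\<close> has a tangent line at \<open>P\<close>, namely \<open>{P + t *\<^sub>R v | t. True}\<close>.\<close>

definition tangent_direction :: "(real^2) set \<Rightarrow> real^2 \<Rightarrow> real^2 \<Rightarrow> bool" where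
  "tangent_direction S P v \<longleftrightarrow> v \<noteq> 0 \<and> tangent_vectors S P = span {v}"

text \<open>Unsigned angle in \<open>[0, pi]\<close>; meaningful only for nonzero vectors.\<close>

definition vec_angle :: "real^2 \<Rightarrow> real^2 \<Rightarrow> real" where
  "vec_angle u v = arccos (u \<bullet> v / (norm u * norm v))"

text \<open>The sides \<open>PA\<close> and \<open>PB\<close> make congruent angles with the two opposite rays into which
  \<open>P\<close> divides the tangent line. Replacing \<open>v\<close> by another spanning vector changes nothing:
  reversing it turns both angles into their supplements.\<close>

definition reflection_law :: "(real^2) set \<Rightarrow> real^2 \<Rightarrow> real^2 \<Rightarrow> real^2 \<Rightarrow> bool" where
  "reflection_law S A P B \<longleftrightarrow>
     (\<exists>v. tangent_direction S P v \<and> vec_angle (A - P) v = vec_angle (B - P) (- v))"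

text \<open>The list gives the vertices in cyclic order, so that the neighbours of vertex \<open>i\<close> are
  taken modulo the length.\<close>

definition closed_billiard_trajectory :: "(real^2) set \<Rightarrow> (real^2) list \<Rightarrow> bool" where
  "closed_billiard_trajectory S ps \<longleftrightarrow>
     (let n = length ps in
        2 \<le> n \<and> set ps \<subseteq> S \<and>
        (\<forall>i<n. ps ! i \<noteq> ps ! ((i + 1) mod n)) \<and>
        (\<forall>i<n. reflection_law S (ps ! ((i + n - 1) mod n)) (ps ! i) (ps ! ((i + 1) mod n))))"

definition parallelogram :: "real^2 \<Rightarrow> real^2 \<Rightarrow> real^2 \<Rightarrow> real^2 \<Rightarrow> bool" where
  "parallelogram A B C D \<longleftrightarrow> B - A = C - D \<and> \<not> collinear {A, B, C}"

end

(* Let Z be the centre of the parallelogram, a = A - Z, b = B - Z, p = |a - b|, q = |a + b|.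
   By the reflection law the tangents at A and C are both parallel to the exterior bisector
   direction v = (p - q) a + (p + q) b.  Points of an ellipse with parallel tangents are antipodal,
   so the ellipse is centred at Z and has a and a multiple w of v as conjugate semi-diameters;
   passing through B forces w = v / (2 sqrt (p q)).  Conversely, the ellipse
   Z + cos t a + sin t w passes through all vertices, and its tangent at B is parallel to
   (p + q) a + (p - q) b.  This is v with a and b exchanged, that is, the exterior bisector at B. *)

theory Submission
  imports Defs
begin

section \<open>Quadratic equation of an ellipse with given foci\<close>

text \<open>Polar form of the ellipse with centre 0, foci \<open>f\<close> and \<open>-f\<close> and
  semi-major axis \<open>s\<close>, cleared of denominators: along the axes its quadratic form is
  b^2 x^2 + s^2 y^2 with b^2 = s^2 - |f|^2. Being coordinate-free, it covers circles as
  \<open>f = 0\<close>.\<close>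

definition focal_form :: "real^2 \<Rightarrow> real \<Rightarrow> real^2 \<Rightarrow> real^2 \<Rightarrow> real" where
  "focal_form f s X Y = s\<^sup>2 * (X \<bullet> Y) - (X \<bullet> f) * (Y \<bullet> f)"

lemma focal_form_add_left: "focal_form f s (X + Y) Z = focal_form f s X Z + focal_form f s Y Z"
  and focal_form_add_right: "focal_form f s Z (X + Y) = focal_form f s Z X + focal_form f s Z Y"
  and focal_form_scaleR_left: "focal_form f s (r *\<^sub>R X) Z = r * focal_form f s X Z"
  and focal_form_scaleR_right: "focal_form f s Z (r *\<^sub>R X) = r * focal_form f s Z X"
  by (simp_all add: focal_form_def inner_simps algebra_simps)

lemma focal_form_commute: "focal_form f s X Y = focal_form f s Y X"
  by (simp add: focal_form_def inner_commute)

lemmas focal_form_simps = focal_form_add_left focal_form_add_right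
  focal_form_scaleR_left focal_form_scaleR_right

text \<open>Cauchy-Schwarz. For \<open>norm f < s\<close> this is positive definiteness.\<close>

lemma focal_form_ge: "(s\<^sup>2 - (norm f)\<^sup>2) * (norm Y)\<^sup>2 \<le> focal_form f s Y Y"
proof -
  have "(Y \<bullet> f)\<^sup>2 \<le> (norm Y)\<^sup>2 * (norm f)\<^sup>2"
    using Cauchy_Schwarz_ineq[of Y f] by (simp add: power2_norm_eq_inner)
  then show ?thesis
    by (simp add: focal_form_def flip: power2_norm_eq_inner) (simp add: power2_eq_square algebra_simps)
qed

text \<open>Both sides amount to \<open>N = s\<^sup>2 + (e / s)\<^sup>2\<close>, because the focal
  distances of a point of the ellipse are \<open>s - e / s\<close> and
  \<open>s + e / s\<close>.\<close>

lemma focal_sum_eq_iff: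
  fixes f Y :: "real^2"
  assumes "norm f < s"
  shows "norm (Y - f) + norm (Y + f) = 2 * s \<longleftrightarrow> focal_form f s Y Y = s\<^sup>2 * (s\<^sup>2 - (norm f)\<^sup>2)"
proof -
  define e N where "e = Y \<bullet> f" and "N = (norm Y)\<^sup>2 + (norm f)\<^sup>2"
  have s: "s > 0" using assms norm_ge_zero[of f] by linarith
  have fs: "(norm f)\<^sup>2 < s\<^sup>2" using assms by (simp add: power_strict_mono)
  have d1: "(norm (Y - f))\<^sup>2 = N - 2 * e" and d2: "(norm (Y + f))\<^sup>2 = N + 2 * e"
    by (simp_all add: e_def N_def power2_norm_eq_inner inner_simps inner_commute)
  have quad: "focal_form f s Y Y = s\<^sup>2 * (s\<^sup>2 - (norm f)\<^sup>2) \<longleftrightarrow> N = s\<^sup>2 + (e / s)\<^sup>2"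
    using s unfolding focal_form_def N_def e_def power2_norm_eq_inner[symmetric]
    by (auto simp: field_simps power2_eq_square)
  show ?thesis
  proof
    assume sum: "norm (Y - f) + norm (Y + f) = 2 * s"
    \<comment> \<open>The squared distances differ by \<open>4 * e\<close>; dividing by their known
      sum yields the difference of the distances.\<close>
    have "4 * e = (norm (Y + f) - norm (Y - f)) * (norm (Y - f) + norm (Y + f))"
      using d1 d2 by (simp add: power2_eq_square algebra_simps)
    then have "norm (Y + f) - norm (Y - f) = 2 * e / s"
      unfolding sum using s by (simp add: field_simps)
    then have "norm (Y + f) = s + e / s" using sum by linarith
    then have "N + 2 * e = (s + e / s)\<^sup>2" using d2 by simp
    then have "N = s\<^sup>2 + (e / s)\<^sup>2" using s by (simp add: power2_sum)
    then show "focal_form f s Y Y = s\<^sup>2 * (s\<^sup>2 - (norm f)\<^sup>2)" using quad by simp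
  next
    assume eq: "focal_form f s Y Y = s\<^sup>2 * (s\<^sup>2 - (norm f)\<^sup>2)"
    then have N: "N = s\<^sup>2 + (e / s)\<^sup>2" using quad by simp
    \<comment> \<open>Taking square roots requires \<open>s + e / s\<close> and
      \<open>s - e / s\<close> to be nonnegative. The level set lies in the disc of radius
      \<open>s\<close>, which bounds \<open>e\<close> by s^2.\<close>
    have "(s\<^sup>2 - (norm f)\<^sup>2) * (norm Y)\<^sup>2 \<le> (s\<^sup>2 - (norm f)\<^sup>2) * s\<^sup>2"
      using focal_form_ge[of s f Y] eq by (simp add: mult.commute)
    then have "(norm Y)\<^sup>2 \<le> s\<^sup>2" using fs by simp
    then have "norm Y \<le> s" using s by (simp add: abs_le_square_iff[symmetric])
    then have "norm Y * norm f \<le> s * s" using assms s by (intro mult_mono) auto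
    then have "\<bar>e\<bar> \<le> s * s" using Cauchy_Schwarz_ineq2[of Y f] unfolding e_def by linarith
    then have "\<bar>e / s\<bar> \<le> s" using s by (simp add: field_simps)
    then have pos: "s + e / s \<ge> 0" "s - e / s \<ge> 0" by linarith+
    have "(norm (Y - f))\<^sup>2 = (s - e / s)\<^sup>2" "(norm (Y + f))\<^sup>2 = (s + e / s)\<^sup>2"
      using s by (simp_all add: d1 d2 N power2_sum power2_diff)
    then have "norm (Y - f) = s - e / s" "norm (Y + f) = s + e / s"
      using pos by simp_all
    then show "norm (Y - f) + norm (Y + f) = 2 * s" by simp
  qed
qed

lemma ellipse_iff_focal_form:
  "ellipse E \<longleftrightarrow> (\<exists>Z f s. norm f < s \<and>
     E = {X. focal_form f s (X - Z) (X - Z) = s\<^sup>2 * (s\<^sup>2 - (norm f)\<^sup>2)})"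
proof
  assume "ellipse E"
  then obtain F1 F2 c where c: "dist F1 F2 < c" and E: "E = {X. dist X F1 + dist X F2 = c}"
    unfolding ellipse_def by blast
  define Z f where "Z = (1/2) *\<^sub>R (F1 + F2)" and "f = (1/2) *\<^sub>R (F1 - F2)"
  have F: "F1 = Z + f" "F2 = Z - f"
    by (simp_all add: Z_def f_def vec_eq_iff field_simps)
  have n: "norm f < c / 2"
    using c by (simp add: f_def dist_norm)
  have "E = {X. norm ((X - Z) - f) + norm ((X - Z) + f) = 2 * (c / 2)}"
    by (simp add: E F dist_norm algebra_simps)
  then show "\<exists>Z f s. norm f < s \<and>
     E = {X. focal_form f s (X - Z) (X - Z) = s\<^sup>2 * (s\<^sup>2 - (norm f)\<^sup>2)}"
    unfolding focal_sum_eq_iff[OF n] using n by blast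
next
  assume "\<exists>Z f s. norm f < s \<and>
     E = {X. focal_form f s (X - Z) (X - Z) = s\<^sup>2 * (s\<^sup>2 - (norm f)\<^sup>2)}"
  then obtain Z f s where n: "norm f < s"
    and E: "E = {X. focal_form f s (X - Z) (X - Z) = s\<^sup>2 * (s\<^sup>2 - (norm f)\<^sup>2)}" by blast
  have "E = {X. dist X (Z + f) + dist X (Z - f) = 2 * s}"
    unfolding E focal_sum_eq_iff[OF n, symmetric] by (simp add: dist_norm algebra_simps)
  moreover have "dist (Z + f) (Z - f) = norm (2 *\<^sub>R f)"
    by (simp add: dist_norm scaleR_2)
  then have "dist (Z + f) (Z - f) < 2 * s" using n by simp
  ultimately show "ellipse E" unfolding ellipse_def by blast
qed

section \<open>Ellipses given by conjugate semi-diameters\<close>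

text \<open>Cramer's rule.\<close>

lemma plane_expansion:
  fixes u w Y :: "real^2"
  assumes "u$1 * w$2 \<noteq> u$2 * w$1"
  obtains x y where "Y = x *\<^sub>R u + y *\<^sub>R w"
proof
  define d where "d = u$1 * w$2 - u$2 * w$1"
  have d: "d \<noteq> 0" using assms by (simp add: d_def)
  have "d * Y$1 = (Y$1 * w$2 - Y$2 * w$1) * u$1 + (u$1 * Y$2 - u$2 * Y$1) * w$1"
    "d * Y$2 = (Y$1 * w$2 - Y$2 * w$1) * u$2 + (u$1 * Y$2 - u$2 * Y$1) * w$2"
    by (simp_all add: d_def algebra_simps)
  then show "Y = ((Y$1 * w$2 - Y$2 * w$1) / d) *\<^sub>R u + ((u$1 * Y$2 - u$2 * Y$1) / d) *\<^sub>R w"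
    using d by (simp add: vec_eq_iff forall_2 nonzero_eq_divide_eq mult.commute flip: add_divide_distrib)
qed

text \<open>Affine image of the unit circle, with \<open>u\<close> and \<open>w\<close> as conjugate
  semi-diameters when they are independent. The pair \<open>x\<close>, \<open>y\<close> replaces
  cosine and sine of an angle, so that computations stay polynomial.\<close>

definition conjugate_ellipse :: "real^2 \<Rightarrow> real^2 \<Rightarrow> real^2 \<Rightarrow> (real^2) set" where
  "conjugate_ellipse Z u w = {Z + x *\<^sub>R u + y *\<^sub>R w | x y. x\<^sup>2 + y\<^sup>2 = 1}"

text \<open>In the basis \<open>u\<close>, \<open>w\<close> the quadratic form is \<open>K\<close>
  times the sum of the squared coordinates, so its level \<open>K\<close> is the unit circle of that
  basis.\<close>

lemma focal_level_set_eq_conjugate_ellipse: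
  assumes "u$1 * w$2 \<noteq> u$2 * w$1" "K \<noteq> 0"
    and "focal_form f s u u = K" "focal_form f s w w = K" "focal_form f s u w = 0"
  shows "{X. focal_form f s (X - Z) (X - Z) = K} = conjugate_ellipse Z u w"
proof -
  have val: "focal_form f s (x *\<^sub>R u + y *\<^sub>R w) (x *\<^sub>R u + y *\<^sub>R w) = (x\<^sup>2 + y\<^sup>2) * K" for x y
    using assms by (simp add: focal_form_simps focal_form_commute[of f s w u] power2_eq_square algebra_simps)
  show ?thesis
  proof (rule set_eqI)
    fix X
    obtain x y where xy: "X - Z = x *\<^sub>R u + y *\<^sub>R w" using plane_expansion[OF assms(1)] by blast
    then have X: "X = Z + x *\<^sub>R u + y *\<^sub>R w" by (simp add: algebra_simps)
    have "X \<in> conjugate_ellipse Z u w" if "x\<^sup>2 + y\<^sup>2 = 1"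
      using that X unfolding conjugate_ellipse_def by blast
    moreover have "focal_form f s (X - Z) (X - Z) = K" if X: "X \<in> conjugate_ellipse Z u w"
    proof -
      obtain x' y' where X': "X = Z + x' *\<^sub>R u + y' *\<^sub>R w" and "x'\<^sup>2 + y'\<^sup>2 = 1"
        using X unfolding conjugate_ellipse_def by blast
      moreover have "X - Z = x' *\<^sub>R u + y' *\<^sub>R w" by (simp add: X')
      ultimately show ?thesis by (simp add: val)
    qed
    ultimately show "X \<in> {X. focal_form f s (X - Z) (X - Z) = K} \<longleftrightarrow> X \<in> conjugate_ellipse Z u w"
      using val[of x y] xy assms(2) by auto
  qed
qed

text \<open>In complex notation the foci of the ellipse with conjugate semi-diameters \<open>u\<close> and \<open>w\<close>
  are, relative to the centre, the square roots of \<open>u\<^sup>2 + w\<^sup>2\<close>.\<close>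

lemma conjugate_diameters_focal_form:
  assumes "u$1 * w$2 \<noteq> u$2 * w$1"
  obtains f s where "norm f < s"
    "focal_form f s u u = s\<^sup>2 * (s\<^sup>2 - (norm f)\<^sup>2)"
    "focal_form f s w w = s\<^sup>2 * (s\<^sup>2 - (norm f)\<^sup>2)" "focal_form f s u w = 0"
proof -
  \<comment> \<open>Real part and half the imaginary part of the complex number u^2 + w^2.\<close>
  define R I where "R = (u$1)\<^sup>2 - (u$2)\<^sup>2 + (w$1)\<^sup>2 - (w$2)\<^sup>2" and "I = u$1 * u$2 + w$1 * w$2"
  define S where "S = u \<bullet> u + w \<bullet> w"
  define z where "z = csqrt (Complex R (2 * I))"
  define f :: "real^2" where "f = vector [Re z, Im z]"
  define N where "N = (norm f)\<^sup>2"
  \<comment> \<open>By Apollonius \<open>S\<close> is the sum of the squared semi-axes;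
    \<open>N\<close>, the squared distance from centre to focus, is their difference. Half of
    \<open>S + N\<close> is thus the larger square.\<close>
  define s where "s = sqrt ((S + N) / 2)"
  have "z\<^sup>2 = Complex R (2 * I)" by (simp add: z_def)
  then have f: "(f$1)\<^sup>2 - (f$2)\<^sup>2 = R" "f$1 * f$2 = I"
    by (simp_all add: f_def complex_eq_iff power2_eq_square mult.commute)
  have N: "N = (f$1)\<^sup>2 + (f$2)\<^sup>2"
    unfolding N_def power2_norm_eq_inner by (simp add: inner_vec_def sum_2 power2_eq_square)
  have S: "S = (u$1)\<^sup>2 + (u$2)\<^sup>2 + (w$1)\<^sup>2 + (w$2)\<^sup>2"
    by (simp add: S_def inner_vec_def sum_2 power2_eq_square)
  have N2: "N\<^sup>2 = R\<^sup>2 + 4 * I\<^sup>2"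
    unfolding N f[symmetric] by algebra
  \<comment> \<open>The nonzero determinant makes \<open>N < S\<close>, which is
    \<open>norm f < s\<close>.\<close>
  have SN: "S\<^sup>2 - N\<^sup>2 = 4 * (u$1 * w$2 - u$2 * w$1)\<^sup>2"
    unfolding N2 S R_def I_def by algebra
  have S0: "S \<ge> 0" "N \<ge> 0" by (simp_all add: S_def N_def)
  have "S\<^sup>2 - N\<^sup>2 > 0" unfolding SN using assms by simp
  then have "N < S" using S0 by (simp add: power2_less_imp_less)
  then have s2: "s\<^sup>2 = (S + N) / 2" and nf: "norm f < s"
    using S0 by (simp_all add: s_def real_less_rsqrt N_def)
  have K: "s\<^sup>2 * (s\<^sup>2 - (norm f)\<^sup>2) = (u$1 * w$2 - u$2 * w$1)\<^sup>2"
    using SN unfolding N_def[symmetric] s2 by (simp add: power2_eq_square field_simps)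
  \<comment> \<open>This eliminates \<open>f\<close> and \<open>s\<close>: only \<open>S\<close>,
    \<open>R\<close> and \<open>I\<close> remain, so the required values become polynomial
    identities in the coordinates of \<open>u\<close> and \<open>w\<close>.\<close>
  have form: "focal_form f s X Y =
      (S * (X$1 * Y$1 + X$2 * Y$2) - R * (X$1 * Y$1 - X$2 * Y$2) - 2 * I * (X$1 * Y$2 + X$2 * Y$1)) / 2"
    for X Y
    unfolding focal_form_def s2 N f[symmetric] inner_vec_def sum_2
    by (simp add: power2_eq_square field_simps)
  show thesis
    by (rule that[OF nf]; unfold K form S R_def I_def; simp add: power2_eq_square field_simps)
qed

lemma focal_level_pos:
  assumes "norm f < s"
  shows "s\<^sup>2 * (s\<^sup>2 - (norm f)\<^sup>2) > 0"
proof -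
  have "(norm f)\<^sup>2 < s\<^sup>2" using assms by (simp add: power_strict_mono)
  moreover have "s > 0" using assms norm_ge_zero[of f] by linarith
  ultimately show ?thesis by simp
qed

lemma ellipse_conjugate_ellipse:
  assumes "u$1 * w$2 \<noteq> u$2 * w$1"
  shows "ellipse (conjugate_ellipse Z u w)"
proof -
  obtain f s where nf: "norm f < s"
    and "focal_form f s u u = s\<^sup>2 * (s\<^sup>2 - (norm f)\<^sup>2)"
      "focal_form f s w w = s\<^sup>2 * (s\<^sup>2 - (norm f)\<^sup>2)" "focal_form f s u w = 0"
    using conjugate_diameters_focal_form[OF assms] by blast
  then have "{X. focal_form f s (X - Z) (X - Z) = s\<^sup>2 * (s\<^sup>2 - (norm f)\<^sup>2)} = conjugate_ellipse Z u w"
    using assms focal_level_pos[OF nf] by (intro focal_level_set_eq_conjugate_ellipse) auto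
  then show ?thesis using nf unfolding ellipse_iff_focal_form by blast
qed

section \<open>Tangents and conjugate directions\<close>

text \<open>Differentiate the constant value \<open>K\<close> along a curve: a tangent vector is
  conjugate to the radius of its point.\<close>

lemma tangent_vector_focal_form:
  assumes "v \<in> tangent_vectors {X. focal_form f s (X - Z) (X - Z) = K} P"
  shows "focal_form f s v (P - Z) = 0"
proof -
  obtain \<gamma> where g0: "\<gamma> 0 = P" and g: "\<And>t. focal_form f s (\<gamma> t - Z) (\<gamma> t - Z) = K"
    and d: "(\<gamma> has_vector_derivative v) (at 0)"
    using assms unfolding tangent_vectors_def by auto
  have "(\<gamma> has_derivative (\<lambda>h. h *\<^sub>R v)) (at 0)"
    using d by (simp add: has_vector_derivative_def)
  then have "((\<lambda>t. focal_form f s (\<gamma> t - Z) (\<gamma> t - Z)) has_derivative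
      (\<lambda>h. 2 * h * focal_form f s v (P - Z))) (at 0)"
    unfolding focal_form_def
    by (auto intro!: derivative_eq_intros simp: g0 algebra_simps inner_commute fun_eq_iff)
  then have "(\<lambda>h. 2 * h * focal_form f s v (P - Z)) = (\<lambda>h. 0)"
    unfolding g using has_derivative_const has_derivative_unique by blast
  from fun_cong[OF this, of 1] show ?thesis by simp
qed

text \<open>Rotating the parameter pair supplies enough curves for one inclusion; conjugacy to the
  radius gives the other.\<close>

lemma tangent_vectors_conjugate_ellipse:
  assumes indep: "u$1 * w$2 \<noteq> u$2 * w$1" and xy: "x\<^sup>2 + y\<^sup>2 = 1"
  shows "tangent_vectors (conjugate_ellipse Z u w) (Z + x *\<^sub>R u + y *\<^sub>R w) = span {x *\<^sub>R w - y *\<^sub>R u}"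
    (is "?T = span {?v}")
proof (intro set_eqI iffI)
  fix v assume "v \<in> span {?v}"
  then obtain c where v: "v = c *\<^sub>R ?v" by (auto simp: span_singleton)
  \<comment> \<open>The parameter pair is rotated by the angle \<open>c * t\<close>, which gives
    initial velocity \<open>v\<close>.\<close>
  define \<gamma> where "\<gamma> t = Z + cos (c * t) *\<^sub>R (x *\<^sub>R u + y *\<^sub>R w) + sin (c * t) *\<^sub>R ?v" for t
  have "(\<gamma> has_vector_derivative v) (at 0)"
    unfolding \<gamma>_def v by (auto intro!: derivative_eq_intros)
  moreover have "\<gamma> t \<in> conjugate_ellipse Z u w" for t
  proof -
    define x' y' where "x' = cos (c * t) * x - sin (c * t) * y" and "y' = cos (c * t) * y + sin (c * t) * x"
    have "x'\<^sup>2 + y'\<^sup>2 = (x\<^sup>2 + y\<^sup>2) * ((sin (c * t))\<^sup>2 + (cos (c * t))\<^sup>2)"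
      unfolding x'_def y'_def by algebra
    then have "x'\<^sup>2 + y'\<^sup>2 = 1" by (simp add: xy)
    moreover have "\<gamma> t = Z + x' *\<^sub>R u + y' *\<^sub>R w"
      by (simp add: \<gamma>_def x'_def y'_def algebra_simps)
    ultimately show ?thesis unfolding conjugate_ellipse_def by blast
  qed
  moreover have "\<gamma> 0 = Z + x *\<^sub>R u + y *\<^sub>R w" by (simp add: \<gamma>_def)
  ultimately show "v \<in> ?T" unfolding tangent_vectors_def by blast
next
  fix v assume v: "v \<in> ?T"
  obtain f s where nf: "norm f < s"
    and form: "focal_form f s u u = s\<^sup>2 * (s\<^sup>2 - (norm f)\<^sup>2)"
      "focal_form f s w w = s\<^sup>2 * (s\<^sup>2 - (norm f)\<^sup>2)" "focal_form f s u w = 0"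
    using conjugate_diameters_focal_form[OF indep] by blast
  define K where "K = s\<^sup>2 * (s\<^sup>2 - (norm f)\<^sup>2)"
  have K: "K \<noteq> 0" using focal_level_pos[OF nf] unfolding K_def by linarith
  have "{X. focal_form f s (X - Z) (X - Z) = K} = conjugate_ellipse Z u w"
    using focal_level_set_eq_conjugate_ellipse[OF indep K] form by (simp add: K_def)
  then have v0: "focal_form f s v (x *\<^sub>R u + y *\<^sub>R w) = 0"
    using tangent_vector_focal_form[of v f s Z K] v by (metis add.assoc add_diff_cancel_left')
  obtain p q where pq: "v = p *\<^sub>R u + q *\<^sub>R w" using plane_expansion[OF indep] by blast
  have "K * (p * x + q * y) = 0"
    using v0 form unfolding pq K_def[symmetric]
    by (simp add: focal_form_simps focal_form_commute[of f s w u] algebra_simps)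
  then have pxqy: "p * x + q * y = 0" using K by simp
  \<comment> \<open>The pair (p, q) is orthogonal to the unit vector (x, y), hence a multiple of
    (-y, x) with factor \<open>q * x - p * y\<close>.\<close>
  have "p = (q * x - p * y) * - y" "q = (q * x - p * y) * x"
    using pxqy xy by algebra+
  then have "v = (q * x - p * y) *\<^sub>R ?v"
    unfolding pq by (metis (no_types, lifting) add.commute scaleR_minus_left
        scaleR_right_diff_distrib scaleR_scaleR uminus_add_conv_diff mult_minus_right)
  then show "v \<in> span {?v}" by (auto simp: span_singleton)
qed

text \<open>Each coordinate of \<open>n\<close> times the determinant of \<open>X\<close> and
  \<open>Y\<close> is 0, so the determinant vanishes.\<close>

lemma orthogonal_plane:
  fixes n X Y :: "real^2"
  assumes "n \<noteq> 0" "n \<bullet> X = 0" "n \<bullet> Y = 0" "X \<noteq> 0"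
  shows "Y \<in> span {X}"
proof -
  have perp: "n$1 * X$1 + n$2 * X$2 = 0" "n$1 * Y$1 + n$2 * Y$2 = 0"
    using assms by (simp_all add: inner_vec_def sum_2)
  have "n$1 * (X$1 * Y$2 - X$2 * Y$1) = 0" "n$2 * (X$1 * Y$2 - X$2 * Y$1) = 0"
    using perp by algebra+
  then have cross: "X$1 * Y$2 = X$2 * Y$1" using assms by (auto simp: vec_eq_iff forall_2)
  have "(X \<bullet> X) *\<^sub>R Y = (X \<bullet> Y) *\<^sub>R X"
    using cross by (simp add: vec_eq_iff forall_2 inner_vec_def sum_2) algebra
  then have "Y = ((X \<bullet> Y) / (X \<bullet> X)) *\<^sub>R X"
    using assms(4) by (metis eq_vector_fraction_iff inner_eq_zero_iff)
  then show ?thesis by (auto simp: span_singleton)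
qed

text \<open>Pairing with \<open>v\<close> is a nonzero functional by positive definiteness, and its
  kernel is a line. Applied to radii: points whose tangents are parallel to \<open>v\<close> lie on
  one diameter.\<close>

lemma focal_form_tangent_plane:
  assumes "norm f < s" "v \<noteq> 0" "focal_form f s v X = 0" "focal_form f s v Y = 0" "X \<noteq> 0"
  shows "Y \<in> span {X}"
proof (rule orthogonal_plane)
  define n where "n = s\<^sup>2 *\<^sub>R v - (v \<bullet> f) *\<^sub>R f"
  have n: "focal_form f s v W = n \<bullet> W" for W
    by (simp add: n_def focal_form_def inner_simps inner_commute)
  have "(norm f)\<^sup>2 < s\<^sup>2" using assms(1) by (simp add: power_strict_mono)
  then have "0 < (s\<^sup>2 - (norm f)\<^sup>2) * (norm v)\<^sup>2" using assms(2) by simp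
  then have "n \<bullet> v > 0" using focal_form_ge[of s f v] n[of v] by linarith
  then show "n \<noteq> 0" by auto
  show "n \<bullet> X = 0" "n \<bullet> Y = 0" using assms(3,4) unfolding n by simp_all
qed fact

section \<open>The reflection law as orthogonality to a bisector\<close>

text \<open>The cosines lie in [-1, 1], where \<open>arccos\<close> is injective. The vector tested
  is the sum of the unit vectors along the sides, scaled by both lengths, so it points along the
  internal bisector unless it is 0.\<close>

lemma reflection_law_iff:
  assumes "A \<noteq> P" "B \<noteq> P"
  shows "reflection_law S A P B \<longleftrightarrow> (\<exists>v. tangent_direction S P v \<and>
    (norm (B - P) *\<^sub>R (A - P) + norm (A - P) *\<^sub>R (B - P)) \<bullet> v = 0)"
proof -
  have "vec_angle (A - P) v = vec_angle (B - P) (- v) \<longleftrightarrow>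
      (norm (B - P) *\<^sub>R (A - P) + norm (A - P) *\<^sub>R (B - P)) \<bullet> v = 0" if "v \<noteq> 0" for v
  proof -
    have bd: "\<bar>X \<bullet> Y / (norm X * norm Y)\<bar> \<le> 1" for X Y :: "real^2"
      using Cauchy_Schwarz_ineq2[of X Y] by (cases "X = 0 \<or> Y = 0") (auto simp: divide_le_eq_1)
    have "vec_angle (A - P) v = vec_angle (B - P) (- v) \<longleftrightarrow>
        (A - P) \<bullet> v / (norm (A - P) * norm v) = (B - P) \<bullet> - v / (norm (B - P) * norm (- v))"
      unfolding vec_angle_def using bd[of "A - P" v] bd[of "B - P" "- v"] by (simp only: arccos_eq_iff simp_thms)
    also have "\<dots> \<longleftrightarrow> norm (B - P) * ((A - P) \<bullet> v) + norm (A - P) * ((B - P) \<bullet> v) = 0"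
    proof -
      have "norm (A - P) > 0" "norm (B - P) > 0" "norm v > 0" using assms that by simp_all
      then show ?thesis
        by (simp only: norm_minus_cancel inner_minus_right) (auto simp: field_simps)
    qed
    finally show ?thesis by (simp add: inner_simps)
  qed
  then show ?thesis unfolding reflection_law_def tangent_direction_def by blast
qed

text \<open>At the vertex \<open>a\<close> the sides lead to \<open>-b\<close> and \<open>b\<close>.
  Scaled by \<open>p\<close> and \<open>q\<close> respectively, they have the same length
  \<open>p * q\<close>, so their sum and difference are orthogonal, like the diagonals of a rhombus;
  the second factor is that difference.\<close>

lemma bisector_orthogonal:
  fixes a b :: "real^2"
  defines "p \<equiv> norm (a - b)" and "q \<equiv> norm (a + b)"
  shows "(p *\<^sub>R (- b - a) + q *\<^sub>R (b - a)) \<bullet> ((p - q) *\<^sub>R a + (p + q) *\<^sub>R b) = 0"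
proof -
  have squares: "p\<^sup>2 = a \<bullet> a + b \<bullet> b - 2 * (a \<bullet> b)" "q\<^sup>2 = a \<bullet> a + b \<bullet> b + 2 * (a \<bullet> b)"
    by (simp_all add: p_def q_def power2_norm_eq_inner inner_simps inner_commute)
  have "(p *\<^sub>R (- b - a) + q *\<^sub>R (b - a)) \<bullet> ((p - q) *\<^sub>R a + (p + q) *\<^sub>R b) =
      - (p\<^sup>2 - q\<^sup>2) * (a \<bullet> a + b \<bullet> b) - 2 * (p\<^sup>2 + q\<^sup>2) * (a \<bullet> b)"
    by (simp add: inner_simps inner_commute[of b a] power2_eq_square algebra_simps)
  then show ?thesis unfolding squares by (simp add: algebra_simps)
qed

section \<open>Parallelograms and their billiard ellipse\<close>

lemma parallelogram_centre:
  assumes "parallelogram A B C D"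
  obtains Z a b where "A = Z + a" "B = Z + b" "C = Z - a" "D = Z - b" "a$1 * b$2 \<noteq> a$2 * b$1"
proof
  define Z where "Z = (1/2) *\<^sub>R (A + C)"
  have D: "D = A + C - B" and ncol: "\<not> collinear {A, B, C}"
    using assms unfolding parallelogram_def by (auto simp: algebra_simps)
  show "A = Z + (A - Z)" "B = Z + (B - Z)" "C = Z - (A - Z)" "D = Z - (B - Z)"
    by (simp_all add: Z_def D vec_eq_iff field_simps)
  show "(A - Z)$1 * (B - Z)$2 \<noteq> (A - Z)$2 * (B - Z)$1"
  proof
    assume "(A - Z)$1 * (B - Z)$2 = (A - Z)$2 * (B - Z)$1"
    then have cross: "(A$1 - C$1) * (B$2 - C$2) = (A$2 - C$2) * (B$1 - C$1)"
      by (simp add: Z_def field_simps)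
    have ne: "B \<noteq> C" using ncol by auto
    \<comment> \<open>A normal of \<open>B - C\<close>; the vanishing determinant makes it a normal
      of \<open>A - C\<close> too, which forces collinearity.\<close>
    define n :: "real^2" where "n = vector [C$2 - B$2, B$1 - C$1]"
    have "n \<noteq> 0" "n \<bullet> (B - C) = 0" "n \<bullet> (A - C) = 0"
      using ne cross by (auto simp: n_def vec_eq_iff forall_2 inner_vec_def sum_2 algebra_simps)
    then have "A - C \<in> span {B - C}" using ne by (intro orthogonal_plane) auto
    then obtain c where "A - C = c *\<^sub>R (B - C)" by (auto simp: span_singleton)
    then have "A = c *\<^sub>R B + (1 - c) *\<^sub>R C" by (simp add: algebra_simps)
    then have "collinear {B, A, C}" by (auto simp: collinear_3_expand)
    then show False using ncol by (simp add: insert_commute)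
  qed
qed

lemma closed_billiard_trajectory_4:
  "closed_billiard_trajectory S [A, B, C, D] \<longleftrightarrow>
     A \<in> S \<and> B \<in> S \<and> C \<in> S \<and> D \<in> S \<and> A \<noteq> B \<and> B \<noteq> C \<and> C \<noteq> D \<and> D \<noteq> A \<and>
     reflection_law S D A B \<and> reflection_law S A B C \<and>
     reflection_law S B C D \<and> reflection_law S C D A"
proof -
  have all: "(\<forall>i<4. P i) \<longleftrightarrow> P 0 \<and> P 1 \<and> P 2 \<and> P 3" for P :: "nat \<Rightarrow> bool"
    by (auto simp: numeral_eq_Suc less_Suc_eq)
  have len: "length [A, B, C, D] = 4" by simp
  show ?thesis
    unfolding closed_billiard_trajectory_def Let_def len all by simp
qed

text \<open>Independence of \<open>u\<close> and \<open>w\<close> keeps the velocity at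
  \<open>P\<close> from vanishing, so it can serve as the witness in
  \<open>reflection_law_iff\<close>.\<close>

lemma reflection_law_conjugate_ellipse:
  assumes indep: "u$1 * w$2 \<noteq> u$2 * w$1" and xy: "x\<^sup>2 + y\<^sup>2 = 1"
    and P: "P = Z + x *\<^sub>R u + y *\<^sub>R w" and ne: "A \<noteq> P" "B \<noteq> P"
    and perp: "(norm (B - P) *\<^sub>R (A - P) + norm (A - P) *\<^sub>R (B - P)) \<bullet> (x *\<^sub>R w - y *\<^sub>R u) = 0"
  shows "reflection_law (conjugate_ellipse Z u w) A P B"
proof -
  have "x *\<^sub>R w - y *\<^sub>R u \<noteq> 0"
  proof
    assume "x *\<^sub>R w - y *\<^sub>R u = 0"
    then have "x * w$1 = y * u$1" "x * w$2 = y * u$2"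
      by (simp_all add: vec_eq_iff forall_2)
    then have "x * (u$1 * w$2 - u$2 * w$1) = 0" "y * (u$1 * w$2 - u$2 * w$1) = 0"
      by algebra+
    then have "x = 0" "y = 0" using indep by auto
    then show False using xy by simp
  qed
  then have "tangent_direction (conjugate_ellipse Z u w) P (x *\<^sub>R w - y *\<^sub>R u)"
    unfolding tangent_direction_def P using tangent_vectors_conjugate_ellipse[OF indep xy] by blast
  then show ?thesis unfolding reflection_law_iff[OF ne] using perp by blast
qed

theorem theorem6p3:
  fixes A B C D :: "real^2"
  assumes "parallelogram A B C D"
  shows "\<exists>!E. ellipse E \<and> closed_billiard_trajectory E [A, B, C, D]"
proof -
  obtain Z a b where vert: "A = Z + a" "B = Z + b" "C = Z - a" "D = Z - b"
    and ab: "a$1 * b$2 \<noteq> a$2 * b$1"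
    using parallelogram_centre[OF assms] by blast
  have ne: "a \<noteq> b" "a + b \<noteq> 0" using ab by (auto simp: add_eq_0_iff)
  define p q where "p = norm (a - b)" and "q = norm (a + b)"
  have pq: "p > 0" "q > 0" using ne by (simp_all add: p_def q_def)
  define r where "r = sqrt (p * q)"
  have r: "r > 0" "r\<^sup>2 = p * q" using pq by (simp_all add: r_def)
  define v where "v = (p - q) *\<^sub>R a + (p + q) *\<^sub>R b"
  \<comment> \<open>Internal bisector at \<open>A\<close>, scaled.\<close>
  define n where "n = p *\<^sub>R (- b - a) + q *\<^sub>R (b - a)"
  define w where "w = (1 / (2 * r)) *\<^sub>R v"
  \<comment> \<open>Coordinates of \<open>b\<close> in the basis \<open>a\<close>, \<open>w\<close>,
    found by solving \<open>v = (2 * r) *\<^sub>R w\<close> for \<open>b\<close>. They lie on the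
    unit circle because r^2 = p q and (q - p)^2 + 4 p q = (p + q)^2.\<close>
  define x y where "x = (q - p) / (p + q)" and "y = 2 * r / (p + q)"
  have v: "v = (2 * r) *\<^sub>R w" using r by (simp add: w_def)
  have nv: "n \<bullet> v = 0" unfolding n_def v_def p_def q_def by (rule bisector_orthogonal)
  have norms: "norm (b - a) = p" "norm (- a - b) = q" "norm (- b - a) = q" "norm (b + a) = q"
    "norm (a - b) = p" "norm (a + b) = q"
    by (simp_all add: p_def q_def norm_minus_commute add.commute)
  have "(p + q)\<^sup>2 \<noteq> 0" using pq by simp
  moreover have "x\<^sup>2 + y\<^sup>2 = ((q - p)\<^sup>2 + 4 * r\<^sup>2) / (p + q)\<^sup>2"
    by (simp add: x_def y_def power_divide add_divide_distrib power_mult_distrib)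
  moreover have "(q - p)\<^sup>2 + 4 * r\<^sup>2 = (p + q)\<^sup>2" unfolding r(2) by algebra
  ultimately have xy: "x\<^sup>2 + y\<^sup>2 = 1" by simp
  have y0: "y \<noteq> 0" using r pq by (simp add: y_def)
  have "(p + q) *\<^sub>R b = (q - p) *\<^sub>R a + (2 * r) *\<^sub>R w"
    unfolding v[symmetric] v_def by (simp add: algebra_simps)
  then have "(1 / (p + q)) *\<^sub>R ((p + q) *\<^sub>R b) = (1 / (p + q)) *\<^sub>R ((q - p) *\<^sub>R a + (2 * r) *\<^sub>R w)"
    by simp
  then have b: "b = x *\<^sub>R a + y *\<^sub>R w"
    using pq by (simp add: x_def y_def scaleR_right_distrib)
  have aw: "a$1 * w$2 \<noteq> a$2 * w$1"
    using ab unfolding b by (auto simp: algebra_simps)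
  define E where "E = conjugate_ellipse Z a w"
  have xwya: "x *\<^sub>R w - y *\<^sub>R a = (- 1 / (2 * r)) *\<^sub>R ((p - q) *\<^sub>R b + (p + q) *\<^sub>R a)"
  proof -
    \<comment> \<open>Denominators are cleared first; with r^2 = p q the factor \<open>p + q\<close>
      splits off again and cancels.\<close>
    have "(p + q) *\<^sub>R (2 * r) *\<^sub>R (x *\<^sub>R w - y *\<^sub>R a) = (q - p) *\<^sub>R v - (4 * r\<^sup>2) *\<^sub>R a"
      using pq by (simp add: v x_def y_def scaleR_right_diff_distrib power2_eq_square)
    also have "\<dots> = - ((p + q) *\<^sub>R ((p - q) *\<^sub>R b + (p + q) *\<^sub>R a))"
      unfolding v_def r(2) by (simp add: vec_eq_iff algebra_simps)
    finally have "(p + q) *\<^sub>R ((2 * r) *\<^sub>R (x *\<^sub>R w - y *\<^sub>R a)) = (p + q) *\<^sub>R - ((p - q) *\<^sub>R b + (p + q) *\<^sub>R a)"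
      by (simp only: scaleR_minus_right)
    then have "(2 * r) *\<^sub>R (x *\<^sub>R w - y *\<^sub>R a) = - ((p - q) *\<^sub>R b + (p + q) *\<^sub>R a)"
      using pq by (subst (asm) scaleR_cancel_left) auto
    then have "(1 / (2 * r)) *\<^sub>R ((2 * r) *\<^sub>R (x *\<^sub>R w - y *\<^sub>R a)) = (1 / (2 * r)) *\<^sub>R - ((p - q) *\<^sub>R b + (p + q) *\<^sub>R a)"
      by simp
    then show ?thesis using r by (simp add: scaleR_right_distrib scaleR_right_diff_distrib)
  qed
  have nw: "n \<bullet> w = 0" using nv by (simp add: w_def)
  have perpB: "(p *\<^sub>R (- a - b) + q *\<^sub>R (a - b)) \<bullet> (x *\<^sub>R w - y *\<^sub>R a) = 0"
    using bisector_orthogonal[of b a] unfolding xwya by (simp add: norms)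
  show ?thesis
  proof (rule ex1I[of _ E], intro conjI)
    show "ellipse E" unfolding E_def by (rule ellipse_conjugate_ellipse[OF aw])
    have mem: "Z + s *\<^sub>R a + t *\<^sub>R w \<in> E" if "s\<^sup>2 + t\<^sup>2 = 1" for s t
      using that unfolding E_def conjugate_ellipse_def by blast
    \<comment> \<open>Opposite vertices have opposite parameter pairs.\<close>
    have coord: "A = Z + 1 *\<^sub>R a + 0 *\<^sub>R w" "B = Z + x *\<^sub>R a + y *\<^sub>R w"
      "C = Z + (- 1) *\<^sub>R a + 0 *\<^sub>R w" "D = Z + (- x) *\<^sub>R a + (- y) *\<^sub>R w"
      by (simp_all add: vert b)
    have "A \<in> E" "B \<in> E" "C \<in> E" "D \<in> E"
      unfolding coord by (rule mem; simp add: xy)+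
    moreover have dist: "A \<noteq> B" "B \<noteq> C" "C \<noteq> D" "D \<noteq> A"
      using ne by (auto simp: vert algebra_simps eq_neg_iff_add_eq_0)
    moreover have "reflection_law E D A B"
      unfolding E_def using dist
      by (intro reflection_law_conjugate_ellipse[OF aw _ coord(1)])
         (use nw in \<open>simp_all add: vert norms n_def\<close>)
    moreover have "reflection_law E A B C"
      unfolding E_def using dist
      by (intro reflection_law_conjugate_ellipse[OF aw _ coord(2)])
         (use perpB xy in \<open>simp_all add: vert norms add.commute\<close>)
    moreover have "reflection_law E B C D"
      unfolding E_def using dist
      by (intro reflection_law_conjugate_ellipse[OF aw _ coord(3)])
         (use nw in \<open>simp_all add: vert norms n_def inner_simps algebra_simps\<close>)
    moreover have "reflection_law E C D A"
      unfolding E_def using dist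
      by (intro reflection_law_conjugate_ellipse[OF aw _ coord(4)])
         (use perpB xy in \<open>simp_all add: vert norms inner_simps algebra_simps\<close>)
    ultimately show "closed_billiard_trajectory E [A, B, C, D]"
      unfolding closed_billiard_trajectory_4 by blast
  next
    fix E' assume E': "ellipse E' \<and> closed_billiard_trajectory E' [A, B, C, D]"
    obtain O' f s where fs: "norm f < s"
      and level: "E' = {X. focal_form f s (X - O') (X - O') = s\<^sup>2 * (s\<^sup>2 - (norm f)\<^sup>2)}"
      using E' unfolding ellipse_iff_focal_form by blast
    define K where "K = s\<^sup>2 * (s\<^sup>2 - (norm f)\<^sup>2)"
    have K: "K > 0" using focal_level_pos[OF fs] by (simp add: K_def)
    have mem: "A \<in> E'" "B \<in> E'" "C \<in> E'" and dist: "A \<noteq> B" "B \<noteq> C" "C \<noteq> D" "D \<noteq> A"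
      and refl: "reflection_law E' D A B" "reflection_law E' B C D"
      using E' unfolding closed_billiard_trajectory_4 by blast+
    have n0: "n \<noteq> 0"
    proof
      assume "n = 0"
      then have "(q - p) * b$1 = (p + q) * a$1" "(q - p) * b$2 = (p + q) * a$2"
        by (simp_all add: n_def vec_eq_iff forall_2 algebra_simps)
      then have "(p + q) * (a$1 * b$2 - a$2 * b$1) = 0" by algebra
      then show False using pq ab by simp
    qed
    \<comment> \<open>In the plane, orthogonality to the nonzero \<open>n\<close> leaves only one
      direction, so a tangent obeying the reflection law is parallel to \<open>v\<close>.\<close>
    have tangent: "focal_form f s v (P - O') = 0"
      if "tangent_direction E' P v'" "n \<bullet> v' = 0" for P v'
    proof -
      have "v \<in> span {v'}"
        using that nv n0 by (intro orthogonal_plane[of n]) (auto simp: tangent_direction_def)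
      then have "v \<in> tangent_vectors E' P" using that by (simp add: tangent_direction_def)
      then show ?thesis unfolding level by (rule tangent_vector_focal_form)
    qed
    have "focal_form f s v (A - O') = 0"
      using refl(1) dist tangent
      by (subst (asm) reflection_law_iff) (auto simp: vert norms n_def)
    moreover have "focal_form f s v (C - O') = 0"
    proof -
      obtain v' where v': "tangent_direction E' C v'"
        "(norm (D - C) *\<^sub>R (B - C) + norm (B - C) *\<^sub>R (D - C)) \<bullet> v' = 0"
        using refl(2) dist by (subst (asm) reflection_law_iff) auto
      \<comment> \<open>The half-turn about \<open>Z\<close> carries the bisector at
        \<open>A\<close> to the one at \<open>C\<close>, so the tangent there is again parallel to
        \<open>v\<close>.\<close>
      moreover have "norm (D - C) *\<^sub>R (B - C) + norm (B - C) *\<^sub>R (D - C) = - n"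
        by (simp add: vert norms n_def algebra_simps)
      ultimately show ?thesis using tangent by simp
    qed
    moreover have v0: "v \<noteq> 0" using aw r unfolding v by auto
    moreover have "A - O' \<noteq> 0"
      using mem(1) K unfolding level K_def[symmetric] by (auto simp: focal_form_def)
    \<comment> \<open>Both radii are conjugate to \<open>v\<close>, so \<open>A\<close> and
      \<open>C\<close> lie on one diameter of \<open>E'\<close>.\<close>
    ultimately have "C - O' \<in> span {A - O'}"
      using focal_form_tangent_plane[OF fs] by blast
    then obtain c where c: "C - O' = c *\<^sub>R (A - O')" by (auto simp: span_singleton)
    have val: "focal_form f s (A - O') (A - O') = K" "focal_form f s (B - O') (B - O') = K"
      "focal_form f s (C - O') (C - O') = K"
      using mem unfolding level K_def by auto
    \<comment> \<open>Equal levels leave \<open>c\<close> = 1 or -1, and 1 would merge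
      \<open>A\<close> with \<open>C\<close>. They are therefore antipodal, and \<open>O'\<close> is
      their midpoint.\<close>
    have "c\<^sup>2 * K = K"
      using val(1,3) unfolding c focal_form_scaleR_left focal_form_scaleR_right
      by (simp add: power2_eq_square mult.assoc)
    then have "c\<^sup>2 = 1" using K by simp
    moreover have "c \<noteq> 1"
    proof
      assume "c = 1"
      then have "A = C" using c by simp
      then show False using ab by (simp add: vert vec_eq_iff forall_2)
    qed
    ultimately have "c = - 1" by (simp add: power2_eq_1_iff)
    then have O': "O' = Z" using c by (simp add: vert vec_eq_iff algebra_simps)
    have aa: "focal_form f s a a = K" and bb: "focal_form f s b b = K"
      using val by (simp_all add: O' vert)
    have "focal_form f s v a = 0" using \<open>focal_form f s v (A - O') = 0\<close> by (simp add: O' vert)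
    then have wa: "focal_form f s w a = 0" "focal_form f s a w = 0"
      by (simp_all add: w_def focal_form_simps focal_form_commute[of f s a])
    \<comment> \<open>The level at \<open>b\<close>, whose mixed terms vanish, determines the level
      at \<open>w\<close> since \<open>y\<close> is nonzero. Then \<open>a\<close> and
      \<open>w\<close> are conjugate semi-diameters of \<open>E'\<close>, which fixes it.\<close>
    have "K = x\<^sup>2 * K + y\<^sup>2 * focal_form f s w w"
      using bb unfolding b by (simp add: focal_form_simps wa aa power2_eq_square)
    then have "y\<^sup>2 * focal_form f s w w = y\<^sup>2 * K" using xy by algebra
    then have "focal_form f s w w = K" using y0 by simp
    then show "E' = E"
      using focal_level_set_eq_conjugate_ellipse[OF aw] K aa wa
      unfolding level E_def O' K_def[symmetric] by simp
  qed
qed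

end
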